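(* For all Borel probability measures $\sigma_1,\sigma_2,\sigma,\mu_1,\mu_2,\mu$ on $\mathbb{R}$ and all real $t\ge 1$, the following hold. (1) $\mathbb{A}^\lor_{\sigma_1}\circ\mathbb{A}^\lor_{\sigma_2}=\mathbb{A}^\lor_{\sigma_1\lor\sigma_2}$ as maps on the set of Borel probability measures on $\mathbb{R}$. (2) $\mathbb{A}^\lor_\sigma(\mu_1\vee_{\mathrm{f}}\mu_2)=\mathbb{A}^\lor_\sigma(\mu_1)\vee_{\mathrm{f}}\mathbb{A}^\lor_\sigma(\mu_2)$. (3) $\mathbb{A}^\lor_\sigma(\mu^{\vee_{\mathrm{f}}t})=\mathbb{A}^\lor_\sigma(\mu)^{\vee_{\mathrm{f}}t}$. (4) If $\sigma,\mu$ are probability measures on $\mathbb{R}_{\ge0}=[0,\infty)$, then $\sigma\vee_{\mathrm{f}}\mu=\mathbb{A}^\lor_\sigma(\mu)\vee_{\mathrm{b}}\mathbb{A}^\lor_\mu(\sigma)$.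
   Context: For a Borel probability measure $\mu$ on $\mathbb{R}$, $F_\mu(x):=\mu((-\infty,x])$ is its distribution function and $\overline{F}_\mu:=1-F_\mu$ its tail. Probability measures on $\mathbb{R}_{\ge 0}$ are regarded as probability measures on $\mathbb{R}$ with $F_\mu(x)=0$ for $x<0$. Max-convolutions, defined through distribution functions: - Classical max-convolution $\mu\lor\nu$: $F_{\mu\lor\nu}(x):=F_\mu(x)F_\nu(x)$, $x\in\mathbb{R}$. - Free max-convolution, written here $\mu\vee_{\mathrm{f}}\nu$: $F_{\mu\vee_{\mathrm{f}}\nu}(x):=\max\{F_\mu(x)+F_\nu(x)-1,0\}$, $x\in\mathbb{R}$. - Free max-convolution power, for $t\ge1$: $F_{\mu^{\vee_{\mathrm{f}}t}}(x):=\max\{tF_\mu(x)-(t-1),0\}$, $x\in\mathbb{R}$. - Boolean max-convolution of probability measures $\mu,\nu$ on $\mathbb{R}_{\ge0}$, written here $\mu\vee_{\mathrm{b}}\nu$, is the probability measure on $\mathbb{R}_{\ge0}$ with $$F_{\mu\vee_{\mathrm{b}}\nu}(x):=\frac{F_\mu(x)F_\nu(x)}{F_\mu(x)+F_\nu(x)-F_\mu(x)F_\nu(x)},\quad x\ge0,$$ where the value is $0$ if $F_\mu(x)=0$ or $F_\nu(x)=0$. For Borel probability measures $\sigma,\mu$ on $\mathbb{R}$, $\mathbb{A}^\lor_\sigma(\mu)$ is the probability measure on $\mathbb{R}$ with distribution function $$F_{\mathbb{A}^\lor_\sigma(\mu)}(x):=\max\left\{1-\frac{\overline{F}_\mu(x)}{F_\sigma(x)},0\right\},$$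 where $F_{\mathbb{A}^\lor_\sigma(\mu)}(x)=0$ if $F_\sigma(x)=0$. (This is a distribution function for all $\sigma,\mu$.)
   Formalization: The distribution function of A^∨_σ(μ) is taken to be the right-continuous version of the displayed formula, which can fail right-continuity at one point where F_σ=0 and F_μ=1 (e.g. σ uniform on [0,1], μ=δ_0); where the formula is right-continuous the two agree. *)

theory Defs
  imports "HOL-Probability.Probability"
begin

text \<open>
  Borel probability measures on the real line are the measures \<open>M\<close> with \<^term>\<open>real_distribution M\<close>;
  their distribution functions are \<^const>\<open>cdf\<close>. A measure prescribed by its distribution function
  \<open>F\<close> is \<^term>\<open>interval_measure F\<close>; the lemmas below confirm that the constructions are probability
  measures with the prescribed distribution functions.
\<close>

definition tail :: "real measure \<Rightarrow> real \<Rightarrow> real" where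
  "tail M x = 1 - cdf M x"

definition nonneg_distribution :: "real measure \<Rightarrow> bool" where
  "nonneg_distribution M \<longleftrightarrow> real_distribution M \<and> (\<forall>x<0. cdf M x = 0)"

definition max_conv :: "real measure \<Rightarrow> real measure \<Rightarrow> real measure" where
  "max_conv M N = interval_measure (\<lambda>x. cdf M x * cdf N x)"

definition free_max_conv :: "real measure \<Rightarrow> real measure \<Rightarrow> real measure" where
  "free_max_conv M N = interval_measure (\<lambda>x. max (cdf M x + cdf N x - 1) 0)"

definition free_max_power :: "real measure \<Rightarrow> real \<Rightarrow> real measure" where
  "free_max_power M t = interval_measure (\<lambda>x. max (t * cdf M x - (t - 1)) 0)"

definition bool_max_cdf :: "real measure \<Rightarrow> real measure \<Rightarrow> real \<Rightarrow> real" where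
  "bool_max_cdf M N x =
     (if x < 0 \<or> cdf M x = 0 \<or> cdf N x = 0 then 0
      else cdf M x * cdf N x / (cdf M x + cdf N x - cdf M x * cdf N x))"

definition bool_max_conv :: "real measure \<Rightarrow> real measure \<Rightarrow> real measure" where
  "bool_max_conv M N = interval_measure (bool_max_cdf M N)"

definition A_max_fun :: "real measure \<Rightarrow> real measure \<Rightarrow> real \<Rightarrow> real" where
  "A_max_fun S M x = (if cdf S x = 0 then 0 else max (1 - tail M x / cdf S x) 0)"

text \<open>
  The function \<^term>\<open>A_max_fun S M\<close> is nondecreasing with limits 0 and 1, but it can fail to be right
  continuous at one point: if \<open>S\<close> is uniform on \<open>[0,1]\<close> and \<open>M\<close> is the point mass at 0, then its
  value is 0 at 0 and 1 to the right of 0. The measure is therefore defined through the right limits,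
  which only changes the value at such a point (lemmas \<open>cdf_A_max\<close> and \<open>cdf_A_max_right_cont\<close>).
\<close>

definition A_max :: "real measure \<Rightarrow> real measure \<Rightarrow> real measure" where
  "A_max S M = interval_measure (\<lambda>x. Lim (at_right x) (A_max_fun S M))"


subsection \<open>Well-definedness\<close>

lemma interval_measure_wf:
  fixes F :: "real \<Rightarrow> real"
  assumes "\<And>x y. x \<le> y \<Longrightarrow> F x \<le> F y" "\<And>a. (F \<longlongrightarrow> F a) (at_right a)"
    "(F \<longlongrightarrow> 0) at_bot" "(F \<longlongrightarrow> 1) at_top"
  shows "real_distribution (interval_measure F)" "cdf (interval_measure F) = F"
  using assms real_distribution_interval_measure[of F] cdf_interval_measure[of F]
  by (auto simp: continuous_within)

context
  fixes M :: "real measure"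
  assumes M: "real_distribution M"
begin

interpretation M: real_distribution M by (rule M)

lemma cdf_props:
  "x \<le> y \<Longrightarrow> cdf M x \<le> cdf M y" "0 \<le> cdf M x" "cdf M x \<le> 1"
  "(cdf M \<longlongrightarrow> cdf M x) (at_right x)" "(cdf M \<longlongrightarrow> 0) at_bot" "(cdf M \<longlongrightarrow> 1) at_top"
  using M.cdf_nondecreasing M.cdf_nonneg M.cdf_bounded_prob M.cdf_is_right_cont
    M.cdf_lim_at_bot M.cdf_lim_at_top_prob
  by (auto simp: continuous_within)

end

lemma max_conv_wf:
  assumes M: "real_distribution M" and N: "real_distribution N"
  shows "real_distribution (max_conv M N)" "cdf (max_conv M N) = (\<lambda>x. cdf M x * cdf N x)"
proof -
  note p = cdf_props[OF M] cdf_props[OF N]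
  let ?F = "\<lambda>x. cdf M x * cdf N x"
  have "(?F \<longlongrightarrow> 0 * 0) at_bot" "(?F \<longlongrightarrow> 1 * 1) at_top" "\<And>a. (?F \<longlongrightarrow> ?F a) (at_right a)"
    by (intro tendsto_intros p)+
  moreover have "\<And>x y. x \<le> y \<Longrightarrow> ?F x \<le> ?F y" by (intro mult_mono p)
  ultimately show "real_distribution (max_conv M N)" "cdf (max_conv M N) = ?F"
    unfolding max_conv_def using interval_measure_wf[of ?F] by auto
qed

lemma free_max_conv_wf:
  assumes M: "real_distribution M" and N: "real_distribution N"
  shows "real_distribution (free_max_conv M N)"
    "cdf (free_max_conv M N) = (\<lambda>x. max (cdf M x + cdf N x - 1) 0)"
proof -
  note p = cdf_props[OF M] cdf_props[OF N]
  let ?F = "\<lambda>x. max (cdf M x + cdf N x - 1) 0"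
  have "(?F \<longlongrightarrow> max (0 + 0 - 1) 0) at_bot" "(?F \<longlongrightarrow> max (1 + 1 - 1) 0) at_top"
    "\<And>a. (?F \<longlongrightarrow> ?F a) (at_right a)"
    by (intro tendsto_intros p)+
  moreover have "\<And>x y. x \<le> y \<Longrightarrow> ?F x \<le> ?F y"
    using p(1,7) by (intro max.mono diff_mono add_mono) auto
  ultimately show "real_distribution (free_max_conv M N)" "cdf (free_max_conv M N) = ?F"
    unfolding free_max_conv_def using interval_measure_wf[of ?F] by auto
qed

lemma free_max_power_wf:
  assumes M: "real_distribution M" and t: "t \<ge> 1"
  shows "real_distribution (free_max_power M t)"
    "cdf (free_max_power M t) = (\<lambda>x. max (t * cdf M x - (t - 1)) 0)"
proof -
  note p = cdf_props[OF M]
  let ?F = "\<lambda>x. max (t * cdf M x - (t - 1)) 0"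
  have "(?F \<longlongrightarrow> max (t * 0 - (t - 1)) 0) at_bot" "(?F \<longlongrightarrow> max (t * 1 - (t - 1)) 0) at_top"
    "\<And>a. (?F \<longlongrightarrow> ?F a) (at_right a)"
    by (intro tendsto_intros p)+
  moreover have "\<And>x y. x \<le> y \<Longrightarrow> ?F x \<le> ?F y"
    using p(1) t by (intro max.mono diff_mono mult_left_mono) auto
  ultimately show "real_distribution (free_max_power M t)" "cdf (free_max_power M t) = ?F"
    unfolding free_max_power_def using t interval_measure_wf[of ?F] by auto
qed

lemma bool_fun_bounds:
  fixes a b :: real
  assumes "0 \<le> a" "a \<le> 1" "0 \<le> b" "b \<le> 1"
  shows "0 \<le> a * b / (a + b - a * b)" "a * b / (a + b - a * b) \<le> a"
    "a * b / (a + b - a * b) \<le> b"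
    "a > 0 \<Longrightarrow> a + b - a * b > 0" "b > 0 \<Longrightarrow> a + b - a * b > 0"
proof -
  have "0 \<le> b * (1 - a)" "0 \<le> a * (1 - b)"
    using assms by (auto intro: mult_nonneg_nonneg)
  then have g: "a + b - a * b \<ge> a" "a + b - a * b \<ge> b"
    by (auto simp: algebra_simps)
  then show "a > 0 \<Longrightarrow> a + b - a * b > 0" "b > 0 \<Longrightarrow> a + b - a * b > 0" by linarith+
  show "0 \<le> a * b / (a + b - a * b)"
    using assms g by (intro divide_nonneg_nonneg) auto
  show "a * b / (a + b - a * b) \<le> a"
  proof (cases "a + b - a * b = 0")
    case False
    then have "a + b - a * b > 0" using g assms by linarith
    then show ?thesis using mult_left_mono[OF g(2) assms(1)] by (subst pos_divide_le_eq) auto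
  qed (use assms in auto)
  show "a * b / (a + b - a * b) \<le> b"
  proof (cases "a + b - a * b = 0")
    case False
    then have "a + b - a * b > 0" using g assms by linarith
    then show ?thesis using mult_left_mono[OF g(1) assms(3)] by (subst pos_divide_le_eq) (auto simp: mult.commute)
  qed (use assms in auto)
qed

lemma bool_max_conv_wf:
  assumes M: "nonneg_distribution M" and N: "nonneg_distribution N"
  shows "nonneg_distribution (bool_max_conv M N)"
    "cdf (bool_max_conv M N) = bool_max_cdf M N"
proof -
  have rM: "real_distribution M" and rN: "real_distribution N"
    using M N by (auto simp: nonneg_distribution_def)
  note p = cdf_props[OF rM] and q = cdf_props[OF rN]
  define F where "F = (\<lambda>x. cdf M x * cdf N x / (cdf M x + cdf N x - cdf M x * cdf N x))"
  have F_eq: "bool_max_cdf M N = F"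
  proof
    fix x
    have "cdf M x = 0" if "x < 0"
      using M that by (simp add: nonneg_distribution_def)
    then show "bool_max_cdf M N x = F x"
      unfolding bool_max_cdf_def F_def by (cases "x < 0") simp_all
  qed
  have b: "0 \<le> F x" "F x \<le> cdf M x" "F x \<le> cdf N x" for x
    unfolding F_def by (rule bool_fun_bounds(1-3)[OF p(2,3) q(2,3)])+
  have pos: "cdf M x > 0 \<Longrightarrow> cdf M x + cdf N x - cdf M x * cdf N x > 0" for x
    by (rule bool_fun_bounds(4)[OF p(2,3) q(2,3)])
  have "(F \<longlongrightarrow> 0) at_bot"
    by (rule tendsto_sandwich[OF _ _ tendsto_const p(5)]) (auto intro!: always_eventually b)
  moreover have "(F \<longlongrightarrow> 1 * 1 / (1 + 1 - 1 * 1)) at_top"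
    unfolding F_def by (intro tendsto_intros p q) auto
  moreover have "(F \<longlongrightarrow> F a) (at_right a)" for a
  proof -
    consider "cdf M a = 0" | "cdf N a = 0" | "cdf M a > 0"
      using p(2)[of a] by linarith
    then show ?thesis
    proof cases
      case 1
      then have "F a = 0" "(cdf M \<longlongrightarrow> 0) (at_right a)" using p(4)[of a] by (auto simp: F_def)
      then show ?thesis
        using tendsto_sandwich[OF _ _ tendsto_const, of 0 F "at_right a" "cdf M"] b by simp
    next
      case 2
      then have "F a = 0" "(cdf N \<longlongrightarrow> 0) (at_right a)" using q(4)[of a] by (auto simp: F_def)
      then show ?thesis
        using tendsto_sandwich[OF _ _ tendsto_const, of 0 F "at_right a" "cdf N"] b by simp
    next
      case 3
      then show ?thesis
        unfolding F_def using pos[of a] by (intro tendsto_intros p q) auto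
    qed
  qed
  moreover have "F x \<le> F y" if "x \<le> y" for x y
  proof (cases "cdf M x > 0")
    case False
    then have "F x = 0" using p(2)[of x] by (auto simp: F_def)
    then show ?thesis using b by simp
  next
    case True
    define a c a' c' where d: "a = cdf M x" "c = cdf N x" "a' = cdf M y" "c' = cdf N y"
    have o: "0 \<le> a" "0 \<le> c" "a \<le> a'" "c \<le> c'" using p q that by (auto simp: d)
    have "a + c - a * c > 0" "a' + c' - a' * c' > 0"
      using pos[of x] pos[of y] True p(1)[OF that] by (auto simp: d)
    moreover have "(a * a') * c \<le> (a * a') * c'" "(c * c') * a \<le> (c * c') * a'"
      using o by (intro mult_left_mono; auto)+
    then have "a * c * (a' + c' - a' * c') \<le> a' * c' * (a + c - a * c)"
      by (simp add: algebra_simps)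
    ultimately show ?thesis
      unfolding F_def d[symmetric] by (simp add: frac_le_eq divide_simps mult.commute)
  qed
  ultimately have "real_distribution (bool_max_conv M N)" "cdf (bool_max_conv M N) = F"
    unfolding bool_max_conv_def F_eq using interval_measure_wf[of F] by auto
  then show "nonneg_distribution (bool_max_conv M N)" "cdf (bool_max_conv M N) = bool_max_cdf M N"
    by (simp_all add: nonneg_distribution_def bool_max_cdf_def flip: F_eq)
qed

lemma mono_tendsto_at_right:
  fixes F :: "real \<Rightarrow> real"
  assumes mono: "\<And>x y. x \<le> y \<Longrightarrow> F x \<le> F y"
  shows "(F \<longlongrightarrow> (INF y\<in>{x<..}. F y)) (at_right x)"
proof (rule order_tendstoI)
  have bdd: "bdd_below (F ` {x<..})"
    by (rule bdd_belowI[of _ "F x"]) (auto intro: mono)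
  fix a
  {
    assume "a < (INF y\<in>{x<..}. F y)"
    moreover have "(INF y\<in>{x<..}. F y) \<le> F y" if "y > x" for y
      using that by (intro cINF_lower bdd) auto
    ultimately have "\<forall>y>x. a < F y" by (meson less_le_trans)
    then show "\<forall>\<^sub>F y in at_right x. a < F y"
      by (intro eventually_mono[OF eventually_at_right_less[of x]]) blast
  next
    assume "(INF y\<in>{x<..}. F y) < a"
    then obtain y where "y > x" "F y < a"
      using cINF_less_iff[OF _ bdd] by auto
    then show "\<forall>\<^sub>F y in at_right x. F y < a"
      by (intro eventually_mono[OF eventually_at_right_real[of x y]])
        (meson greaterThanLessThan_iff less_imp_le le_less_trans mono)+
  }
qed

lemma A_max_fun_props:
  assumes S: "real_distribution S" and M: "real_distribution M"
  shows "x \<le> y \<Longrightarrow> A_max_fun S M x \<le> A_max_fun S M y"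
    "0 \<le> A_max_fun S M x" "A_max_fun S M x \<le> cdf M x"
    "(A_max_fun S M \<longlongrightarrow> 0) at_bot" "(A_max_fun S M \<longlongrightarrow> 1) at_top"
    "\<not> (cdf S x = 0 \<and> cdf M x = 1) \<Longrightarrow> (A_max_fun S M \<longlongrightarrow> A_max_fun S M x) (at_right x)"
proof -
  let ?A = "A_max_fun S M"
  note p = cdf_props[OF S] and q = cdf_props[OF M]
  show nn: "0 \<le> ?A x" for x by (auto simp: A_max_fun_def)
  have below: "1 - tail M x / cdf S x \<le> cdf M x" if "cdf S x \<noteq> 0" for x
  proof -
    have "tail M x * cdf S x \<le> tail M x" using p q by (intro mult_left_le) (auto simp: tail_def)
    then have "tail M x \<le> tail M x / cdf S x"
      using that p(2)[of x] by (simp add: le_divide_eq)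
    then show ?thesis by (simp add: tail_def)
  qed
  show le: "?A x \<le> cdf M x" for x
    using below q(2) by (auto simp: A_max_fun_def)
  show "?A x \<le> ?A y" if "x \<le> y" for x y
  proof (cases "cdf S x = 0")
    case True
    then show ?thesis using nn by (simp add: A_max_fun_def)
  next
    case False
    then have s: "cdf S x > 0" using p(2)[of x] by linarith
    then have "cdf S y > 0" using p(1)[OF that] by linarith
    moreover have "tail M y / cdf S y \<le> tail M x / cdf S x"
      using p q that s by (intro frac_le) (auto simp: tail_def)
    ultimately show ?thesis using s by (auto simp: A_max_fun_def)
  qed
  show "(?A \<longlongrightarrow> 0) at_bot"
    by (rule tendsto_sandwich[OF _ _ tendsto_const q(5)]) (auto intro!: always_eventually nn le)
  have "((\<lambda>x. max (1 - tail M x / cdf S x) 0) \<longlongrightarrow> max (1 - (1 - 1) / 1) 0) at_top"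
    unfolding tail_def by (intro tendsto_intros p q) auto
  moreover have "\<forall>\<^sub>F x in at_top. max (1 - tail M x / cdf S x) 0 = ?A x"
    using order_tendstoD(1)[OF p(6), of 0] by (auto simp: A_max_fun_def elim: eventually_mono)
  ultimately show "(?A \<longlongrightarrow> 1) at_top"
    by (simp add: tendsto_cong)
  show "(?A \<longlongrightarrow> ?A x) (at_right x)" if "\<not> (cdf S x = 0 \<and> cdf M x = 1)"
  proof (cases "cdf S x = 0")
    case False
    then have s: "cdf S x > 0" using p(2)[of x] by linarith
    have "((\<lambda>x. max (1 - tail M x / cdf S x) 0) \<longlongrightarrow> max (1 - tail M x / cdf S x) 0) (at_right x)"
      unfolding tail_def using False by (intro tendsto_intros p q) auto
    moreover have "\<forall>\<^sub>F y in at_right x. max (1 - tail M y / cdf S y) 0 = ?A y"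
      using order_tendstoD(1)[OF p(4) s] by (auto simp: A_max_fun_def elim: eventually_mono)
    ultimately have "(?A \<longlongrightarrow> max (1 - tail M x / cdf S x) 0) (at_right x)"
      by (simp add: tendsto_cong)
    then show ?thesis using False by (simp add: A_max_fun_def[of S M x])
  next
    case True
    then have "cdf M x < 1" using that q(3)[of x] by (simp add: less_le)
    then have "tail M x > 0" by (simp add: tail_def)
    have "((\<lambda>y. tail M y - cdf S y) \<longlongrightarrow> tail M x - cdf S x) (at_right x)"
      unfolding tail_def by (intro tendsto_intros p q)
    then have "\<forall>\<^sub>F y in at_right x. tail M y - cdf S y > 0"
      using \<open>tail M x > 0\<close> True by (intro order_tendstoD(1)) auto
    then have "\<forall>\<^sub>F y in at_right x. ?A y = 0"
    proof (rule eventually_mono)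
      fix y assume "0 < tail M y - cdf S y"
      then show "?A y = 0"
        using p(2)[of y] by (auto simp: A_max_fun_def max_def field_simps)
    qed
    then have "(?A \<longlongrightarrow> 0) (at_right x)"
      by (simp add: tendsto_cong)
    then show ?thesis using True by (simp add: A_max_fun_def[of S M x])
  qed
qed

lemma A_max_wf:
  assumes S: "real_distribution S" and M: "real_distribution M"
  shows "real_distribution (A_max S M)"
    "cdf (A_max S M) = (\<lambda>x. Lim (at_right x) (A_max_fun S M))"
    "(A_max_fun S M \<longlongrightarrow> cdf (A_max S M) x) (at_right x)"
proof -
  let ?A = "A_max_fun S M"
  note a = A_max_fun_props[OF S M]
  define G where "G = (\<lambda>x. INF y\<in>{x<..}. ?A y)"
  have lim: "(?A \<longlongrightarrow> G x) (at_right x)" for x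
    unfolding G_def by (rule mono_tendsto_at_right[OF a(1)])
  have G_eq: "(\<lambda>x. Lim (at_right x) ?A) = G"
    by (intro ext tendsto_Lim lim) simp
  have bdd: "bdd_below (?A ` {x<..})" for x
    by (rule bdd_belowI[of _ 0]) (auto intro: a)
  have lo: "?A x \<le> G x" for x
    unfolding G_def by (intro cINF_greatest) (auto intro: a)
  have hi: "G x \<le> ?A y" if "x < y" for x y
    unfolding G_def using that by (intro cINF_lower bdd) auto
  have mono: "G x \<le> G y" if "x \<le> y" for x y
    unfolding G_def using that by (intro cINF_superset_mono bdd) auto
  have rc: "(G \<longlongrightarrow> G x) (at_right x)" for x
  proof (rule order_tendstoI)
    fix b assume "b < G x"
    then show "\<forall>\<^sub>F y in at_right x. b < G y"
      by (intro eventually_mono[OF eventually_at_right_less[of x]])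
        (meson mono less_imp_le less_le_trans)
  next
    fix b assume "G x < b"
    then have "\<forall>\<^sub>F y in at_right x. ?A y < b" using lim order_tendstoD(2) by blast
    then obtain z where "z > x" "\<forall>y. x < y \<and> y < z \<longrightarrow> ?A y < b"
      by (auto simp: eventually_at_right_field)
    then have "G y < b" if "x < y" "y < z" for y
      using hi[of y "(y + z) / 2"] that by (auto intro: le_less_trans)
    then show "\<forall>\<^sub>F y in at_right x. G y < b"
      using \<open>z > x\<close> by (auto simp: eventually_at_right_field)
  qed
  have "filterlim (\<lambda>x::real. x + 1) at_bot at_bot"
    unfolding filterlim_at_bot eventually_at_bot_linorder
    by (metis add_le_cancel_right diff_add_cancel)
  then have "((\<lambda>x. ?A (x + 1)) \<longlongrightarrow> 0) at_bot"
    using filterlim_compose[OF a(4)] by blast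
  then have "(G \<longlongrightarrow> 0) at_bot"
    by (rule tendsto_sandwich[OF _ _ a(4), rotated 2]) (auto intro!: always_eventually lo hi)
  moreover have "filterlim (\<lambda>x::real. x + 1) at_top at_top"
    unfolding filterlim_at_top eventually_at_top_linorder
    by (metis add_le_cancel_right diff_add_cancel)
  then have "((\<lambda>x. ?A (x + 1)) \<longlongrightarrow> 1) at_top"
    using filterlim_compose[OF a(5)] by blast
  then have "(G \<longlongrightarrow> 1) at_top"
    by (rule tendsto_sandwich[OF _ _ a(5), rotated 2]) (auto intro!: always_eventually lo hi)
  ultimately have w: "real_distribution (A_max S M)" "cdf (A_max S M) = G"
    unfolding A_max_def G_eq using interval_measure_wf[of G] mono rc by auto
  show "real_distribution (A_max S M)" by (rule w)
  show "cdf (A_max S M) = (\<lambda>x. Lim (at_right x) ?A)" using w G_eq by simp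
  show "(?A \<longlongrightarrow> cdf (A_max S M) x) (at_right x)" using w lim by simp
qed

lemma cdf_A_max_right_cont:
  assumes "real_distribution S" "real_distribution M"
    and "continuous (at_right x) (A_max_fun S M)"
  shows "cdf (A_max S M) x = A_max_fun S M x"
  using tendsto_unique[OF _ A_max_wf(3)[OF assms(1,2)], of x] assms(3)
  by (auto simp: continuous_within)

lemma cdf_A_max:
  assumes "real_distribution S" "real_distribution M" "\<not> (cdf S x = 0 \<and> cdf M x = 1)"
  shows "cdf (A_max S M) x = A_max_fun S M x"
  using assms A_max_fun_props(6)[OF assms(1,2)]
  by (intro cdf_A_max_right_cont) (auto simp: continuous_within)

end

theory Submission
  imports Defs
begin

text \<open>
  Write \<open>s\<close> and \<open>m\<close> for the values of the distribution functions of \<open>S\<close> and \<open>M\<close> at a point.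
  Clearing the denominator in the definition of \<^const>\<open>A_max_fun\<close> gives
  \<open>A_max_fun S M = max (s + m - 1) 0 / s\<close>: the operator \<^const>\<open>A_max\<close> divides the
  distribution function of the free max-convolution by that of \<open>S\<close>. With this formula each of the
  four identities becomes an identity between real numbers in \<open>[0, 1]\<close>. For the last one, put
  \<open>c = max (s + m - 1) 0\<close>; the Boolean max-convolution adds the quantities \<open>1 / F - 1\<close>, and when
  \<open>c = s + m - 1\<close> is positive, \<open>(s / c - 1) + (m / c - 1) = 1 / c - 1\<close>.

  The remaining point is that the distribution function of \<open>A_max S M\<close> is the right-continuous
  version of \<open>A_max_fun S M\<close>, and the two can differ at a point. Every point nevertheless has a
  right neighbourhood, with the point itself removed, on which they agree
  (\<open>eventually_cdf_A_max\<close>), and by right continuity a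
  probability measure is determined by the values of its distribution function on such
  neighbourhoods (\<open>real_distribution_eqI\<close>). So it suffices to compare the formulas there.
\<close>

lemma real_distribution_eqI:
  assumes M: "real_distribution M" and N: "real_distribution N"
    and eq: "\<And>x. \<forall>\<^sub>F y in at_right x. cdf M y = cdf N y"
  shows "M = N"
proof (rule cdf_unique[OF M N], rule ext)
  fix x
  have "(cdf N \<longlongrightarrow> cdf M x) (at_right x)"
    using cdf_props(4)[OF M, of x] tendsto_cong[OF eq] by blast
  then show "cdf M x = cdf N x"
    using cdf_props(4)[OF N, of x] by (intro tendsto_unique[of "at_right x"]) auto
qed

text \<open>
  Where \<open>cdf S x = 0\<close>, both sides are 0 because of the convention \<open>z / 0 = 0\<close>.
\<close>

lemma A_max_fun_eq_divide:
  assumes "real_distribution S"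
  shows "A_max_fun S M x = max (cdf S x + cdf M x - 1) 0 / cdf S x"
  using cdf_props(2)[OF assms, of x]
  by (auto simp: A_max_fun_def tail_def max_def field_simps)

text \<open>
  The two functions agree at \<open>y\<close> unless \<open>cdf S y = 0\<close> and \<open>cdf M y = 1\<close>. If such \<open>y\<close> occur
  arbitrarily close to the right of \<open>x\<close>, then \<open>S\<close> has no mass on a right neighbourhood of \<open>x\<close>,
  where \<^const>\<open>A_max_fun\<close> is therefore locally constant, hence right continuous.
\<close>

lemma eventually_cdf_A_max:
  assumes S: "real_distribution S" and M: "real_distribution M"
  shows "\<forall>\<^sub>F y in at_right x. cdf (A_max S M) y = A_max_fun S M y"
proof (cases "\<exists>z>x. cdf S z = 0")
  case True
  then obtain z where z: "x < z" "cdf S z = 0" by blast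
  have zero: "A_max_fun S M y = 0" if "y < z" for y
    using cdf_props(1)[OF S, of y z] cdf_props(2)[OF S, of y] z that
    by (auto simp: A_max_fun_def)
  have "cdf (A_max S M) y = A_max_fun S M y" if y: "y < z" for y
  proof (rule cdf_A_max_right_cont[OF S M])
    have "\<forall>\<^sub>F u in at_right y. A_max_fun S M u = 0"
      using y zero by (auto simp: eventually_at_right_field)
    then show "continuous (at_right y) (A_max_fun S M)"
      using zero[OF y] by (simp add: continuous_within tendsto_eventually)
  qed
  then show ?thesis
    using z(1) by (auto simp: eventually_at_right_field)
next
  case False
  then have "cdf (A_max S M) y = A_max_fun S M y" if "x < y" for y
    using that by (intro cdf_A_max[OF S M]) auto
  then show ?thesis
    by (auto intro: eventually_mono[OF eventually_at_right_less[of x]])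
qed

lemma eventually_cdf_A_max_divide:
  assumes S: "real_distribution S" and M: "real_distribution M"
  shows "\<forall>\<^sub>F y in at_right x. cdf (A_max S M) y = max (cdf S y + cdf M y - 1) 0 / cdf S y"
  using eventually_cdf_A_max[OF S M] by (simp add: A_max_fun_eq_divide[OF S])

lemma nonneg_distribution_A_max:
  assumes S: "real_distribution S" and M: "nonneg_distribution M"
  shows "nonneg_distribution (A_max S M)"
proof -
  have rM: "real_distribution M" and M0: "\<And>x. x < 0 \<Longrightarrow> cdf M x = 0"
    using M by (auto simp: nonneg_distribution_def)
  have "cdf (A_max S M) x = A_max_fun S M x" if "x < 0" for x
    using M0[OF that] by (intro cdf_A_max[OF S rM]) auto
  moreover have "A_max_fun S M x = 0" if "x < 0" for x
    using A_max_fun_props(2,3)[OF S rM, of x] M0[OF that] by simp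
  ultimately show ?thesis
    using A_max_wf(1)[OF S rM] by (auto simp: nonneg_distribution_def)
qed

theorem A_max_A_max:
  assumes R: "real_distribution R" and S: "real_distribution S" and M: "real_distribution M"
  shows "A_max R (A_max S M) = A_max (max_conv R S) M"
proof (rule real_distribution_eqI)
  note SM = A_max_wf(1)[OF S M] and RS = max_conv_wf[OF R S]
  show "real_distribution (A_max R (A_max S M))" "real_distribution (A_max (max_conv R S) M)"
    by (rule A_max_wf(1)[OF R SM] A_max_wf(1)[OF RS(1) M])+
  fix x
  show "\<forall>\<^sub>F y in at_right x. cdf (A_max R (A_max S M)) y = cdf (A_max (max_conv R S) M) y"
    using eventually_cdf_A_max_divide[OF R SM, of x] eventually_cdf_A_max_divide[OF S M, of x]
      eventually_cdf_A_max_divide[OF RS(1) M, of x]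
  proof eventually_elim
    case (elim y)
    define r s m where rsm: "r = cdf R y" "s = cdf S y" "m = cdf M y"
    have b: "0 \<le> r" "r \<le> 1" "0 \<le> s" "s \<le> 1" "0 \<le> m" "m \<le> 1"
      using cdf_props(2,3) R S M by (auto simp: rsm)
    have "max (r + max (s + m - 1) 0 / s - 1) 0 / r = max (r * s + m - 1) 0 / (r * s)"
    proof (cases "s = 0")
      case True
      then show ?thesis using b by simp
    next
      case False
      then have s: "0 < s" using b by simp
      have "r * s \<le> s" using b mult_right_mono[of r 1 s] by simp
      \<comment> \<open>since \<open>r * s \<le> s\<close>, truncating \<open>s + m - 1\<close> at 0 is absorbed by the outer truncation\<close>
      then have "max (r * s + max (s + m - 1) 0 - s) 0 = max (r * s + m - 1) 0"
        by (auto simp: max_def)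
      moreover have "max (r + max (s + m - 1) 0 / s - 1) 0
          = max (r * s + max (s + m - 1) 0 - s) 0 / s"
        using s by (simp add: max_divide_distrib_right add_divide_distrib diff_divide_distrib)
      ultimately show ?thesis by (simp add: mult.commute)
    qed
    then show ?case using elim by (simp add: RS(2) rsm)
  qed
qed

theorem A_max_free_max_conv:
  assumes S: "real_distribution S" and M: "real_distribution M" and N: "real_distribution N"
  shows "A_max S (free_max_conv M N) = free_max_conv (A_max S M) (A_max S N)"
proof (rule real_distribution_eqI)
  note MN = free_max_conv_wf[OF M N] and SM = A_max_wf(1)[OF S M] and SN = A_max_wf(1)[OF S N]
  show "real_distribution (A_max S (free_max_conv M N))"
    "real_distribution (free_max_conv (A_max S M) (A_max S N))"
    by (rule A_max_wf(1)[OF S MN(1)] free_max_conv_wf(1)[OF SM SN])+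
  fix x
  show "\<forall>\<^sub>F y in at_right x.
      cdf (A_max S (free_max_conv M N)) y = cdf (free_max_conv (A_max S M) (A_max S N)) y"
    using eventually_cdf_A_max_divide[OF S MN(1), of x] eventually_cdf_A_max_divide[OF S M, of x]
      eventually_cdf_A_max_divide[OF S N, of x]
  proof eventually_elim
    case (elim y)
    define s m n where smn: "s = cdf S y" "m = cdf M y" "n = cdf N y"
    have b: "0 \<le> s" "s \<le> 1" "0 \<le> m" "m \<le> 1" "0 \<le> n" "n \<le> 1"
      using cdf_props(2,3) S M N by (auto simp: smn)
    have "max (s + max (m + n - 1) 0 - 1) 0 / s
        = max (max (s + m - 1) 0 / s + max (s + n - 1) 0 / s - 1) 0"
    proof (cases "s = 0")
      case False
      then have s: "0 < s" using b by simp
      have "max (s + max (m + n - 1) 0 - 1) 0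
          = max (max (s + m - 1) 0 + max (s + n - 1) 0 - s) 0"
        using b by (auto simp: max_def)
      then show ?thesis
        using s by (simp add: max_divide_distrib_right add_divide_distrib diff_divide_distrib)
    qed simp
    then show ?case using elim by (simp add: MN(2) free_max_conv_wf(2)[OF SM SN] smn)
  qed
qed

theorem A_max_free_max_power:
  assumes S: "real_distribution S" and M: "real_distribution M" and t: "t \<ge> 1"
  shows "A_max S (free_max_power M t) = free_max_power (A_max S M) t"
proof (rule real_distribution_eqI)
  note Mt = free_max_power_wf[OF M t] and SM = A_max_wf(1)[OF S M]
  show "real_distribution (A_max S (free_max_power M t))"
    "real_distribution (free_max_power (A_max S M) t)"
    by (rule A_max_wf(1)[OF S Mt(1)] free_max_power_wf(1)[OF SM t])+
  fix x
  show "\<forall>\<^sub>F y in at_right x.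
      cdf (A_max S (free_max_power M t)) y = cdf (free_max_power (A_max S M) t) y"
    using eventually_cdf_A_max_divide[OF S Mt(1), of x] eventually_cdf_A_max_divide[OF S M, of x]
  proof eventually_elim
    case (elim y)
    define s m where sm: "s = cdf S y" "m = cdf M y"
    have b: "0 \<le> s" "s \<le> 1" "0 \<le> m" "m \<le> 1"
      using cdf_props(2,3) S M by (auto simp: sm)
    have "max (s + max (t * m - (t - 1)) 0 - 1) 0 / s
        = max (t * (max (s + m - 1) 0 / s) - (t - 1)) 0"
    proof (cases "s = 0")
      case True
      then show ?thesis using t b by simp
    next
      case False
      then have s: "0 < s" using b by simp
      have "max (s + max (t * m - (t - 1)) 0 - 1) 0 = max (s - t * (1 - m)) 0"
        using b by (auto simp: max_def algebra_simps)
      also have "\<dots> = max (t * max (s + m - 1) 0 - (t - 1) * s) 0"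
      proof (cases "s + m \<ge> 1")
        case True
        then show ?thesis by (simp add: algebra_simps)
      next
        case False
        \<comment> \<open>both truncations are active: \<open>s < 1 - m \<le> t * (1 - m)\<close> because \<open>t \<ge> 1\<close>\<close>
        have "1 - m \<le> t * (1 - m)" using b t mult_right_mono[of 1 t "1 - m"] by simp
        moreover have "0 \<le> (t - 1) * s" using b t by simp
        ultimately show ?thesis using False by (simp add: max_def)
      qed
      finally have "max (s + max (t * m - (t - 1)) 0 - 1) 0 / s
          = max ((t * max (s + m - 1) 0 - (t - 1) * s) / s) 0"
        using s by (simp add: max_divide_distrib_right[of _ 0 s])
      also have "(t * max (s + m - 1) 0 - (t - 1) * s) / s
          = t * (max (s + m - 1) 0 / s) - (t - 1)"
        using s by (simp only: diff_divide_distrib times_divide_eq_right) simp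
      finally show ?thesis .
    qed
    then show ?case using elim by (simp add: Mt(2) free_max_power_wf(2)[OF SM t] sm)
  qed
qed

theorem free_max_conv_eq_bool_max_conv:
  assumes S: "nonneg_distribution S" and M: "nonneg_distribution M"
  shows "free_max_conv S M = bool_max_conv (A_max S M) (A_max M S)"
proof (rule real_distribution_eqI)
  have rS: "real_distribution S" and rM: "real_distribution M"
    using S M by (auto simp: nonneg_distribution_def)
  note w = bool_max_conv_wf[OF nonneg_distribution_A_max[OF rS M] nonneg_distribution_A_max[OF rM S]]
  show "real_distribution (free_max_conv S M)" by (rule free_max_conv_wf(1)[OF rS rM])
  show "real_distribution (bool_max_conv (A_max S M) (A_max M S))"
    using w(1) by (simp add: nonneg_distribution_def)
  fix x
  show "\<forall>\<^sub>F y in at_right x.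
      cdf (free_max_conv S M) y = cdf (bool_max_conv (A_max S M) (A_max M S)) y"
    using eventually_cdf_A_max_divide[OF rS rM, of x] eventually_cdf_A_max_divide[OF rM rS, of x]
  proof eventually_elim
    case (elim y)
    define s m c where smc: "s = cdf S y" "m = cdf M y" "c = max (s + m - 1) 0"
    have b: "0 \<le> s" "s \<le> 1" "0 \<le> m" "m \<le> 1"
      using cdf_props(2,3) rS rM by (auto simp: smc)
    have cdfs: "cdf (A_max S M) y = c / s" "cdf (A_max M S) y = c / m"
      using elim by (simp_all add: smc add.commute)
    have "bool_max_cdf (A_max S M) (A_max M S) y = c"
    proof (cases "c = 0")
      case True
      then show ?thesis by (simp add: bool_max_cdf_def cdfs)
    next
      case False
      then have c: "c = s + m - 1" "0 < c" by (auto simp: smc(3) max_def split: if_splits)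
      then have pos: "0 < s" "0 < m" using b by linarith+
      have "\<not> y < 0"
        using pos S by (auto simp: nonneg_distribution_def smc)
      \<comment> \<open>the denominator collapses because \<open>s + m - c = 1\<close>\<close>
      have "c / s + c / m - c / s * (c / m) = c * (s + m - c) / (s * m)"
        using pos by (simp add: field_simps)
      also have "\<dots> = c / (s * m)" using c by simp
      finally have "c / s * (c / m) / (c / s + c / m - c / s * (c / m)) = c"
        using pos c(2) by simp
      then show ?thesis
        using \<open>\<not> y < 0\<close> pos c(2) by (simp add: bool_max_cdf_def cdfs)
    qed
    then show ?case by (simp add: w(2) free_max_conv_wf(2)[OF rS rM] smc)
  qed
qed

theorem theorem1p4:
  fixes \<sigma>\<^sub>1 \<sigma>\<^sub>2 \<sigma> \<mu>\<^sub>1 \<mu>\<^sub>2 \<mu> :: "real measure" and t :: real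
  assumes "real_distribution \<sigma>\<^sub>1" "real_distribution \<sigma>\<^sub>2" "real_distribution \<sigma>"
    and "real_distribution \<mu>\<^sub>1" "real_distribution \<mu>\<^sub>2" "real_distribution \<mu>"
    and "t \<ge> 1"
  shows "(\<forall>\<nu>. real_distribution \<nu> \<longrightarrow>
            (A_max \<sigma>\<^sub>1 \<circ> A_max \<sigma>\<^sub>2) \<nu> = A_max (max_conv \<sigma>\<^sub>1 \<sigma>\<^sub>2) \<nu>) \<and>
         A_max \<sigma> (free_max_conv \<mu>\<^sub>1 \<mu>\<^sub>2) = free_max_conv (A_max \<sigma> \<mu>\<^sub>1) (A_max \<sigma> \<mu>\<^sub>2) \<and>
         A_max \<sigma> (free_max_power \<mu> t) = free_max_power (A_max \<sigma> \<mu>) t \<and>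
         (nonneg_distribution \<sigma> \<and> nonneg_distribution \<mu> \<longrightarrow>
            free_max_conv \<sigma> \<mu> = bool_max_conv (A_max \<sigma> \<mu>) (A_max \<mu> \<sigma>))"
  using assms
  by (simp add: A_max_A_max A_max_free_max_conv A_max_free_max_power free_max_conv_eq_bool_max_conv)

end
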